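(* Assume: (B1) there is a constant $S<\infty$ with $\|\overline S_t(\infty)\|_\infty\le S$ for $t=0,1,\dots,T$; (B2) there is a deterministic function $\beta$ with $\beta(z)$ decreasing to $0$ as $z\to\infty$ (so for every $\varepsilon$ with $\alpha S>\varepsilon>0$ there is $M(\varepsilon)$ with $\beta(z)\le\varepsilon$ for $z\ge M(\varepsilon)$) such that $\max\{\|\underline S_t(z)-\underline S_t(\infty)\|_\infty,\|\overline S_t(z)-\overline S_t(\infty)\|_\infty\}\le\beta(z)$ for all $z\geq 0$ and $t=0,\dots,T$. Then arbitrage on the $M^\alpha$ market implies weak asymptotic arbitrage on the $(G_t)$ market. That is: if there is $\zeta_T=\sum_{t=0}^T\xi_t$ with $\xi_t\in L^0(-\bar K^\alpha_t,\mathcal F_t)$, $\mathbb P\{L^\alpha_T(\zeta_T)\ge0\}=1$ and $\mathbb P\{L_T^\alpha(\zeta_T)>0\}>0$, then there is a sequence $\zeta^n_T=\sum_{t=0}^T\xi^n_t$ with $\xi^n_t\in L^0(-\bar K^\alpha_t,\mathcal F_t)$ such that, for each $n$, $\mathbb P\{L^\alpha_T(\zeta^n_T)\ge0\}=1$ and $\mathbb P\{L^\alpha_T(\zeta^n_T)>0\}>0$, and moreover $$\lim_{n\to\infty}\mathbb P\{\xi^n_t\in -G_t\ \text{for all } t=0,\dots,T\}=1,\quad \liminf_{n\to\infty}\mathbb P\{L_T(\zeta^n_T)\ge0\}=1,\quad \liminf_{n\to\infty}\mathbb P\{L_T(\zeta^n_T)>0\}>0.$$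
   Context: Market with concave transaction costs (the $(G_t)$ market). Let $(\Omega,\mathcal F,(\mathcal F_t)_{t=0,\dots,T},\mathbb P)$ be a filtered probability space in discrete time; all relations between random variables hold $\mathbb P$-a.e. There are fixed-cost constants $b_0\le 0\le a_0$. For each $t$ there are $\mathcal F_t$-measurable random price curves, a bid curve $m\mapsto\underline S_t(m)$, $m\ge0$, and an ask curve $l\mapsto\overline S_t(l)$, $l\ge0$. Selling $m$ assets yields $b_t(m)=b_0+m\underline S_t(m)$; buying $l$ assets costs $a_t(l)=a_0+l\overline S_t(l)$. Standing assumptions: (a1) $m\mapsto\underline S_t(m)$ is increasing and continuous with limit $\underline S_t(\infty)$ at $\infty$, differentiable for large $m$, and $\lim_{m\to\infty}m\underline S_t'(m)=0$; (a2) $m\mapsto b_t(m)$ is increasing and convex; (a3) $l\mapsto\overline S_t(l)$ is decreasing and continuous with limit $\overline S_t(\infty)$ at $\infty$, differentiable for large $l$, and $\lim_{l\to\infty}l\overline S_t'(l)=0$; (a4) $l\mapsto a_t(l)$ is increasing and concave; (a5) $\underline S_t(\infty)<\overline S_t(\infty)$. (Price curves constant in the volume are admitted.) Liquidation function: $L_t(x,y)=x+(b_t(y))^+$ if $y\ge0$, $L_t(x,y)=x-a_t(-y)$ if $y<0$. Solvency set: $G_t=\{(x,y)\in\mathbb R^2: L_t(x,y)\ge0\}$. $L^0(A_t,\mathcal F_t)$ is the set of $\mathcal F_t$-measurable random variables with values in $A_t$. $M^\alpha$ market: $\alpha$ is a constant with $0<\alpha\le\min\big\{\frac{\overline S_t(0)}{\overline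 S_t(\infty)}-1,\ 1-\frac{\underline S_t(0)}{\underline S_t(\infty)}\big\}$ $\mathbb P$-a.s. for $t=0,\dots,T$; the market has proportional costs with bid price $(1-\alpha)\underline S_t(\infty)$ and ask price $(1+\alpha)\overline S_t(\infty)$, liquidation function $L^\alpha_t(x,y)=x+y(1-\alpha)\underline S_t(\infty)$ if $y\ge0$, $L^\alpha_t(x,y)=x+y(1+\alpha)\overline S_t(\infty)$ if $y<0$, and solvency set $\bar K^\alpha_t=\{(x,y):L^\alpha_t(x,y)\ge0\}$. *)

theory Defs
  imports "HOL-Probability.Probability"
begin

text \<open>
  Price curves are written as \<open>bid t \<omega> m\<close> and \<open>ask t \<omega> l\<close>; only volumes \<open>m, l \<ge> 0\<close> and dates
  \<open>t \<le> T\<close> matter. The limit prices at infinite volume are the processes \<open>bid_inf t \<omega>\<close>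
  and \<open>ask_inf t \<omega>\<close>. A portfolio is a pair (cash, number of assets).
  ``Increasing'' and ``decreasing'' are meant in the weak sense, since constant price curves
  are admitted.
\<close>

definition bid_value :: "real \<Rightarrow> (real \<Rightarrow> real) \<Rightarrow> real \<Rightarrow> real" where
  "bid_value b0 Sb m = b0 + m * Sb m"

definition ask_cost :: "real \<Rightarrow> (real \<Rightarrow> real) \<Rightarrow> real \<Rightarrow> real" where
  "ask_cost a0 Sa l = a0 + l * Sa l"

definition bid_curve :: "real \<Rightarrow> (real \<Rightarrow> real) \<Rightarrow> real \<Rightarrow> bool" where
  "bid_curve b0 Sb Sb_inf \<longleftrightarrow>
     mono_on {0..} Sb \<and> continuous_on {0..} Sb \<and> (Sb \<longlongrightarrow> Sb_inf) at_top \<and>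
     (\<forall>\<^sub>F m in at_top. Sb differentiable at m) \<and>
     ((\<lambda>m. m * deriv Sb m) \<longlongrightarrow> 0) at_top \<and>
     mono_on {0..} (bid_value b0 Sb) \<and> convex_on {0..} (bid_value b0 Sb)"

definition ask_curve :: "real \<Rightarrow> (real \<Rightarrow> real) \<Rightarrow> real \<Rightarrow> bool" where
  "ask_curve a0 Sa Sa_inf \<longleftrightarrow>
     antimono_on {0..} Sa \<and> continuous_on {0..} Sa \<and> (Sa \<longlongrightarrow> Sa_inf) at_top \<and>
     (\<forall>\<^sub>F l in at_top. Sa differentiable at l) \<and>
     ((\<lambda>l. l * deriv Sa l) \<longlongrightarrow> 0) at_top \<and>
     mono_on {0..} (ask_cost a0 Sa) \<and> concave_on {0..} (ask_cost a0 Sa)"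

text \<open>
  A random curve is \<open>\<F>\<^sub>t\<close>-measurable if it is jointly measurable in (volume, scenario). For curves
  continuous in every scenario this is the same as measurability at each fixed volume; the joint
  form is used because regularity of the curves is only required almost surely.
\<close>

definition random_curve :: "'a measure \<Rightarrow> ('a \<Rightarrow> real \<Rightarrow> real) \<Rightarrow> bool" where
  "random_curve N S \<longleftrightarrow>
     (\<lambda>(m, \<omega>). S \<omega> m) \<in> borel_measurable (restrict_space borel {0..} \<Otimes>\<^sub>M N)"

locale concave_cost_market =
  prob_space M + filtration "space M" F
  for M :: "'a measure" and F :: "nat \<Rightarrow> 'a measure" +
  fixes T :: nat
    and b0 a0 :: real
    and bid ask :: "nat \<Rightarrow> 'a \<Rightarrow> real \<Rightarrow> real"
    and bid_inf ask_inf :: "nat \<Rightarrow> 'a \<Rightarrow> real"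
  assumes F_subalgebra: "t \<le> T \<Longrightarrow> subalgebra M (F t)"
    and fixed_costs: "b0 \<le> 0" "0 \<le> a0"
    and random_curves: "t \<le> T \<Longrightarrow> random_curve (F t) (bid t)"
      "t \<le> T \<Longrightarrow> random_curve (F t) (ask t)"
    and measurable_inf: "t \<le> T \<Longrightarrow> bid_inf t \<in> borel_measurable (F t)"
      "t \<le> T \<Longrightarrow> ask_inf t \<in> borel_measurable (F t)"
    and bid_curve: "t \<le> T \<Longrightarrow> AE \<omega> in M. bid_curve b0 (bid t \<omega>) (bid_inf t \<omega>)"
    and ask_curve: "t \<le> T \<Longrightarrow> AE \<omega> in M. ask_curve a0 (ask t \<omega>) (ask_inf t \<omega>)"
    and bid_inf_less_ask_inf: "t \<le> T \<Longrightarrow> AE \<omega> in M. bid_inf t \<omega> < ask_inf t \<omega>"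

definition liquidation ::
    "real \<Rightarrow> real \<Rightarrow> (real \<Rightarrow> real) \<Rightarrow> (real \<Rightarrow> real) \<Rightarrow> real \<times> real \<Rightarrow> real" where
  "liquidation b0 a0 Sb Sa = (\<lambda>(x, y).
     if y \<ge> 0 then x + max (bid_value b0 Sb y) 0 else x - ask_cost a0 Sa (- y))"

definition alpha_liquidation :: "real \<Rightarrow> real \<Rightarrow> real \<Rightarrow> real \<times> real \<Rightarrow> real" where
  "alpha_liquidation \<alpha> Sb_inf Sa_inf = (\<lambda>(x, y).
     if y \<ge> 0 then x + y * (1 - \<alpha>) * Sb_inf else x + y * (1 + \<alpha>) * Sa_inf)"

definition solvency_set :: "(real \<times> real \<Rightarrow> real) \<Rightarrow> (real \<times> real) set" where
  "solvency_set L = {z. L z \<ge> 0}"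

text \<open>
  Where \<open>bid_inf t \<omega> = 0\<close> the curve \<open>bid t \<omega>\<close> vanishes at all volumes and the bid quotient below
  is undefined on paper; the HOL convention reads it as 0, so the scenario is not excluded.
  The limit \<open>ask_inf t \<omega>\<close> is a.s. positive in a \<open>concave_cost_market\<close>.
\<close>

definition admissible_alpha ::
    "'a measure \<Rightarrow> nat \<Rightarrow> (nat \<Rightarrow> 'a \<Rightarrow> real \<Rightarrow> real) \<Rightarrow> (nat \<Rightarrow> 'a \<Rightarrow> real \<Rightarrow> real) \<Rightarrow>
     (nat \<Rightarrow> 'a \<Rightarrow> real) \<Rightarrow> (nat \<Rightarrow> 'a \<Rightarrow> real) \<Rightarrow> real \<Rightarrow> bool" where
  "admissible_alpha M T bid ask bid_inf ask_inf \<alpha> \<longleftrightarrow>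
     0 < \<alpha> \<and>
     (\<forall>t\<le>T. AE \<omega> in M.
        \<alpha> \<le> min (ask t \<omega> 0 / ask_inf t \<omega> - 1) (1 - bid t \<omega> 0 / bid_inf t \<omega>))"

definition L_zero :: "'a measure \<Rightarrow> 'a measure \<Rightarrow> ('a \<Rightarrow> (real \<times> real) set) \<Rightarrow> ('a \<Rightarrow> real \<times> real) set"
  where "L_zero M N A = {\<xi> \<in> borel_measurable N. AE \<omega> in M. \<xi> \<omega> \<in> A \<omega>}"

definition L_inf_norm :: "'a measure \<Rightarrow> ('a \<Rightarrow> real) \<Rightarrow> ereal" where
  "L_inf_norm M f = esssup M (\<lambda>\<omega>. ereal \<bar>f \<omega>\<bar>)"

definition terminal_position :: "nat \<Rightarrow> (nat \<Rightarrow> 'a \<Rightarrow> real \<times> real) \<Rightarrow> 'a \<Rightarrow> real \<times> real" where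
  "terminal_position T \<xi> \<omega> = (\<Sum>t\<le>T. \<xi> t \<omega>)"

definition alpha_arbitrage ::
    "'a measure \<Rightarrow> (nat \<Rightarrow> 'a measure) \<Rightarrow> nat \<Rightarrow> real \<Rightarrow> (nat \<Rightarrow> 'a \<Rightarrow> real) \<Rightarrow> (nat \<Rightarrow> 'a \<Rightarrow> real) \<Rightarrow>
     (nat \<Rightarrow> 'a \<Rightarrow> real \<times> real) \<Rightarrow> bool" where
  "alpha_arbitrage M F T \<alpha> bid_inf ask_inf \<xi> \<longleftrightarrow>
     (\<forall>t\<le>T. \<xi> t \<in> L_zero M (F t)
        (\<lambda>\<omega>. uminus ` solvency_set (alpha_liquidation \<alpha> (bid_inf t \<omega>) (ask_inf t \<omega>)))) \<and>
     \<P>(\<omega> in M. alpha_liquidation \<alpha> (bid_inf T \<omega>) (ask_inf T \<omega>) (terminal_position T \<xi> \<omega>) \<ge> 0) = 1 \<and>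
     \<P>(\<omega> in M. alpha_liquidation \<alpha> (bid_inf T \<omega>) (ask_inf T \<omega>) (terminal_position T \<xi> \<omega>) > 0) > 0"

end

theory Submission
  imports Defs
begin

text \<open>
  Scaling an arbitrage of the \<open>M\<^sup>\<alpha>\<close> market by a factor \<open>c > 0\<close> gives an arbitrage again, because the
  \<open>M\<^sup>\<alpha>\<close> liquidation function is positively homogeneous. On the \<open>(G\<^sub>t)\<close> market the scaling makes
  every nonzero trade large, and large volumes are traded near the limit prices. The \<open>M\<^sup>\<alpha>\<close> prices
  are worse than these by the factors \<open>1 - \<alpha>\<close> and \<open>1 + \<alpha>\<close>, so trading the volume \<open>m\<close> on the
  \<open>(G\<^sub>t)\<close> market rather than the \<open>M\<^sup>\<alpha>\<close> market gains about \<open>\<alpha>\<close> times the limit price times \<open>m\<close>, up to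
  the fixed costs, which do not grow. Hence in almost every scenario the \<open>M\<^sup>\<alpha>\<close> value of a scaled
  position is eventually at most its \<open>(G\<^sub>t)\<close> value (lemma \<open>eventually_alpha_liquidation_le\<close>).

  Applied to the trades \<open>- \<xi>\<^sub>t\<close> and to the terminal position, this comparison says that the sequence
  \<open>(n + 1) \<xi>\<close> meets each of the required solvency and positivity conditions from some random index on. A Fatou
  inequality for events (lemma \<open>measure_le_liminf_measure\<close>) turns this into bounds on the
  probabilities.
\<close>

section \<open>Comparison of the two liquidation functions in a fixed scenario\<close>

text \<open>
  Proceeds \<open>b\<^sub>t(m)\<close> that never fall below their value \<open>b\<^sub>0\<close> at volume zero force nonnegative prices.
\<close>

lemma bid_curve_limit_nonneg:
  assumes "bid_curve b0 Sb sb"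
  shows "0 \<le> sb"
proof -
  have lim: "(Sb \<longlongrightarrow> sb) at_top" and mono: "mono_on {0..} (bid_value b0 Sb)"
    using assms by (auto simp: bid_curve_def)
  have "0 \<le> Sb m" if "m > 0" for m
  proof -
    have "bid_value b0 Sb 0 \<le> bid_value b0 Sb m"
      using mono that by (auto intro: mono_onD)
    then show ?thesis
      using that by (simp add: bid_value_def zero_le_mult_iff)
  qed
  then have "\<forall>\<^sub>F m in at_top. 0 \<le> Sb m"
    by (intro eventually_mono[OF eventually_gt_at_top[of 0]])
  then show ?thesis
    using lim by (intro tendsto_lowerbound[of Sb sb at_top]) auto
qed

text \<open>
  A price advantage that stays bounded away from zero outweighs any fixed amount at large volume.
\<close>

lemma eventually_le_volume_times_price_gap:
  fixes p :: "real \<Rightarrow> real"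
  assumes "(p \<longlongrightarrow> d) at_top" "0 < d"
  shows "\<forall>\<^sub>F m in at_top. k \<le> m * p m"
proof -
  have "filterlim (\<lambda>m. p m * m) at_top at_top"
    using assms by (intro filterlim_tendsto_pos_mult_at_top) (auto simp: filterlim_ident)
  then show ?thesis
    by (auto simp: filterlim_at_top mult.commute)
qed

text \<open>
  If \<open>sb = 0\<close>, there is no gap between the bid prices of the two markets, and the fixed cost is
  not recovered by selling more. The comparison survives because the positive part in the
  liquidation function allows the assets to be thrown away, and their value on the \<open>M\<^sup>\<alpha>\<close> market
  is zero.
\<close>

lemma eventually_alpha_liquidation_le:
  assumes bid: "bid_curve b0 Sb sb" and ask: "ask_curve a0 Sa sa"
    and "b0 \<le> 0" "sb < sa" "0 < \<alpha>"
  shows "\<forall>\<^sub>F c in at_top. alpha_liquidation \<alpha> sb sa (c *\<^sub>R z) \<le> liquidation b0 a0 Sb Sa (c *\<^sub>R z)"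
proof (cases z)
  case (Pair x y)
  have sb: "0 \<le> sb" using bid by (rule bid_curve_limit_nonneg)
  consider "y = 0 \<or> y > 0 \<and> sb = 0" | "y > 0" "sb > 0" | "y < 0"
    using sb by linarith
  then show ?thesis
  proof cases
    case 1
    show ?thesis
      using eventually_gt_at_top[of 0]
    proof eventually_elim
      case (elim c)
      then show ?case
        using 1 by (auto simp: Pair alpha_liquidation_def liquidation_def)
    qed
  next
    case 2
    have "((\<lambda>m. Sb m - (1 - \<alpha>) * sb) \<longlongrightarrow> sb - (1 - \<alpha>) * sb) at_top"
      using bid by (auto simp: bid_curve_def intro!: tendsto_intros)
    moreover have "0 < sb - (1 - \<alpha>) * sb"
      using 2 \<open>0 < \<alpha>\<close> by (simp add: algebra_simps)
    ultimately have "\<forall>\<^sub>F m in at_top. - b0 \<le> m * (Sb m - (1 - \<alpha>) * sb)"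
      by (rule eventually_le_volume_times_price_gap)
    moreover have "filterlim (\<lambda>c. c * y) at_top at_top"
      using 2 filterlim_tendsto_pos_mult_at_top[OF tendsto_const _ filterlim_ident, of y]
      by (simp add: mult.commute)
    ultimately have "\<forall>\<^sub>F c in at_top. - b0 \<le> (c * y) * (Sb (c * y) - (1 - \<alpha>) * sb)"
      by (rule eventually_compose_filterlim)
    then show ?thesis
      using eventually_gt_at_top[of 0]
    proof eventually_elim
      case (elim c)
      then have "(c * y) * (1 - \<alpha>) * sb \<le> bid_value b0 Sb (c * y)"
        by (simp add: bid_value_def algebra_simps)
      moreover have "c * y \<ge> 0" using elim 2 by simp
      ultimately show ?case
        by (simp add: Pair alpha_liquidation_def liquidation_def)
    qed
  next
    case 3
    have "((\<lambda>l. (1 + \<alpha>) * sa - Sa l) \<longlongrightarrow> (1 + \<alpha>) * sa - sa) at_top"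
      using ask by (auto simp: ask_curve_def intro!: tendsto_intros)
    moreover have "0 < (1 + \<alpha>) * sa - sa"
      using sb \<open>sb < sa\<close> \<open>0 < \<alpha>\<close> by (simp add: algebra_simps)
    ultimately have "\<forall>\<^sub>F l in at_top. a0 \<le> l * ((1 + \<alpha>) * sa - Sa l)"
      by (rule eventually_le_volume_times_price_gap)
    moreover have "filterlim (\<lambda>c. c * (- y)) at_top at_top"
      using 3 filterlim_tendsto_pos_mult_at_top[OF tendsto_const _ filterlim_ident, of "- y"]
      by (simp add: mult.commute)
    ultimately have "\<forall>\<^sub>F c in at_top. a0 \<le> (c * (- y)) * ((1 + \<alpha>) * sa - Sa (c * (- y)))"
      by (rule eventually_compose_filterlim)
    then show ?thesis
      using eventually_gt_at_top[of 0]
    proof eventually_elim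
      case (elim c)
      then have "ask_cost a0 Sa (- (c * y)) \<le> - ((c * y) * (1 + \<alpha>) * sa)"
        by (simp add: ask_cost_def algebra_simps)
      moreover have "\<not> c * y \<ge> 0" using elim 3 by (simp add: zero_le_mult_iff)
      ultimately show ?case
        by (simp add: Pair alpha_liquidation_def liquidation_def)
    qed
  qed
qed

lemma alpha_liquidation_scaleR:
  assumes "0 < c"
  shows "alpha_liquidation \<alpha> sb sa (c *\<^sub>R z) = c * alpha_liquidation \<alpha> sb sa z"
  using assms
  by (cases z) (auto simp: alpha_liquidation_def algebra_simps zero_le_mult_iff)

lemma eventually_liquidation_of_alpha_liquidation:
  assumes "bid_curve b0 Sb sb" "ask_curve a0 Sa sa" "b0 \<le> 0" "sb < sa" "0 < \<alpha>"
  shows "0 \<le> alpha_liquidation \<alpha> sb sa z \<Longrightarrow>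
      \<forall>\<^sub>F n in sequentially. 0 \<le> liquidation b0 a0 Sb Sa (real (Suc n) *\<^sub>R z)"
    and "0 < alpha_liquidation \<alpha> sb sa z \<Longrightarrow>
      \<forall>\<^sub>F n in sequentially. 0 < liquidation b0 a0 Sb Sa (real (Suc n) *\<^sub>R z)"
proof -
  have lim: "filterlim (\<lambda>n. real (Suc n)) at_top sequentially"
    by (rule filterlim_compose[OF filterlim_real_sequentially filterlim_Suc])
  have ev: "\<forall>\<^sub>F n in sequentially. real (Suc n) * alpha_liquidation \<alpha> sb sa z
      \<le> liquidation b0 a0 Sb Sa (real (Suc n) *\<^sub>R z)"
    using eventually_compose_filterlim[OF eventually_alpha_liquidation_le[OF assms] lim]
    by (simp only: alpha_liquidation_scaleR of_nat_0_less_iff zero_less_Suc)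
  show "\<forall>\<^sub>F n in sequentially. 0 \<le> liquidation b0 a0 Sb Sa (real (Suc n) *\<^sub>R z)"
    if "0 \<le> alpha_liquidation \<alpha> sb sa z"
    using ev by eventually_elim (use that in \<open>auto intro: order_trans[rotated]\<close>)
  show "\<forall>\<^sub>F n in sequentially. 0 < liquidation b0 a0 Sb Sa (real (Suc n) *\<^sub>R z)"
    if "0 < alpha_liquidation \<alpha> sb sa z"
    using ev by eventually_elim (use that in \<open>auto intro: less_le_trans[rotated]\<close>)
qed

lemma uminus_image_solvency_set_iff: "z \<in> uminus ` solvency_set L \<longleftrightarrow> 0 \<le> L (- z)"
  by (auto simp: solvency_set_def intro!: image_eqI[of _ _ "- z"])

section \<open>Scaling an arbitrage\<close>

lemma terminal_position_scaleR:
  "terminal_position T (\<lambda>t \<omega>. c *\<^sub>R \<xi> t \<omega>) \<omega> = c *\<^sub>R terminal_position T \<xi> \<omega>"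
  by (simp add: terminal_position_def scaleR_sum_right)

lemma alpha_arbitrage_scaleR:
  assumes "alpha_arbitrage M F T \<alpha> bid_inf ask_inf \<xi>" "0 < c"
  shows "alpha_arbitrage M F T \<alpha> bid_inf ask_inf (\<lambda>t \<omega>. c *\<^sub>R \<xi> t \<omega>)"
proof -
  have neg: "- (c *\<^sub>R z) = c *\<^sub>R (- z)" for z :: "real \<times> real"
    by simp
  show ?thesis
    using assms unfolding alpha_arbitrage_def L_zero_def
    by (auto simp: uminus_image_solvency_set_iff terminal_position_scaleR neg
        alpha_liquidation_scaleR zero_le_mult_iff zero_less_mult_iff simp del: scaleR_minus_right)
qed

section \<open>Measurability of liquidation values\<close>

text \<open>
  A random curve is measurable on nonnegative volumes only, so the random volume is truncated at
  zero before it is inserted.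
\<close>

lemma measurable_random_curve_at:
  assumes "random_curve N S" "subalgebra M N" "v \<in> borel_measurable M"
  shows "(\<lambda>\<omega>. S \<omega> (max 0 (v \<omega>))) \<in> borel_measurable M"
proof -
  have "(\<lambda>\<omega>. (max 0 (v \<omega>), \<omega>)) \<in> M \<rightarrow>\<^sub>M restrict_space borel {0..} \<Otimes>\<^sub>M N"
  proof (rule measurable_Pair)
    show "(\<lambda>\<omega>. max 0 (v \<omega>)) \<in> M \<rightarrow>\<^sub>M restrict_space borel {0..}"
      using assms(3) by (intro measurable_restrict_space2) auto
    show "(\<lambda>\<omega>. \<omega>) \<in> M \<rightarrow>\<^sub>M N"
      using assms(2) by (auto intro: measurable_from_subalg)
  qed
  from measurable_compose[OF this assms(1)[unfolded random_curve_def]]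
  show ?thesis by simp
qed

lemma measurable_fst_snd_real:
  fixes z :: "'a \<Rightarrow> real \<times> real"
  assumes "z \<in> borel_measurable M"
  shows "(\<lambda>\<omega>. fst (z \<omega>)) \<in> borel_measurable M" "(\<lambda>\<omega>. snd (z \<omega>)) \<in> borel_measurable M"
  by (rule borel_measurable_continuous_on[OF _ assms], intro continuous_intros)+

lemma measurable_liquidation:
  assumes "random_curve N Sb" "random_curve N Sa" "subalgebra M N"
    and z [measurable]: "z \<in> borel_measurable M"
  shows "(\<lambda>\<omega>. liquidation b0 a0 (Sb \<omega>) (Sa \<omega>) (z \<omega>)) \<in> borel_measurable M"
proof -
  have [measurable]: "(\<lambda>\<omega>. fst (z \<omega>)) \<in> borel_measurable M" "(\<lambda>\<omega>. snd (z \<omega>)) \<in> borel_measurable M"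
    by (rule measurable_fst_snd_real[OF z])+
  have [measurable]: "(\<lambda>\<omega>. Sb \<omega> (max 0 (snd (z \<omega>)))) \<in> borel_measurable M"
      "(\<lambda>\<omega>. Sa \<omega> (max 0 (- snd (z \<omega>)))) \<in> borel_measurable M"
    using assms by (auto intro: measurable_random_curve_at)
  have "(\<lambda>\<omega>. liquidation b0 a0 (Sb \<omega>) (Sa \<omega>) (z \<omega>)) = (\<lambda>\<omega>. if snd (z \<omega>) \<ge> 0
      then fst (z \<omega>) + max (b0 + snd (z \<omega>) * Sb \<omega> (max 0 (snd (z \<omega>)))) 0
      else fst (z \<omega>) - (a0 + (- snd (z \<omega>)) * Sa \<omega> (max 0 (- snd (z \<omega>)))))"
    by (auto simp: liquidation_def bid_value_def ask_cost_def split_beta max.absorb2 fun_eq_iff)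
  also have "\<dots> \<in> borel_measurable M"
    by measurable
  finally show ?thesis .
qed

lemma measurable_alpha_liquidation:
  assumes [measurable]: "Sb_inf \<in> borel_measurable M" "Sa_inf \<in> borel_measurable M"
    and z [measurable]: "z \<in> borel_measurable M"
  shows "(\<lambda>\<omega>. alpha_liquidation \<alpha> (Sb_inf \<omega>) (Sa_inf \<omega>) (z \<omega>)) \<in> borel_measurable M"
proof -
  have [measurable]: "(\<lambda>\<omega>. fst (z \<omega>)) \<in> borel_measurable M" "(\<lambda>\<omega>. snd (z \<omega>)) \<in> borel_measurable M"
    by (rule measurable_fst_snd_real[OF z])+
  show ?thesis
    unfolding alpha_liquidation_def split_beta by measurable
qed

section \<open>Events that hold eventually\<close>

text \<open>
  The part of \<open>A\<close> not yet covered by \<open>B n\<close> vanishes pointwise almost everywhere, so its measure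
  tends to zero by dominated convergence.
\<close>

lemma (in finite_measure) measure_le_liminf_measure:
  assumes [measurable]: "A \<in> sets M" "\<And>n. B n \<in> sets M"
    and ev: "AE \<omega> in M. \<omega> \<in> A \<longrightarrow> (\<forall>\<^sub>F n in sequentially. \<omega> \<in> B n)"
  shows "ereal (measure M A) \<le> liminf (\<lambda>n. ereal (measure M (B n)))"
proof -
  have "(\<lambda>n. \<integral>\<omega>. indicator (A - B n) \<omega> \<partial>M) \<longlonglongrightarrow> (\<integral>\<omega>. (0::real) \<partial>M)"
  proof (rule integral_dominated_convergence[where w = "\<lambda>_. 1"])
    show "AE \<omega> in M. (\<lambda>n. indicator (A - B n) \<omega> :: real) \<longlonglongrightarrow> 0"
      using ev
    proof eventually_elim
      case (elim \<omega>)
      show ?case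
      proof (cases "\<omega> \<in> A")
        case True
        then have "\<forall>\<^sub>F n in sequentially. (indicator (A - B n) \<omega> :: real) = 0"
          using elim by (auto elim: eventually_mono)
        then show ?thesis by (rule tendsto_eventually)
      qed simp
    qed
  qed (auto simp: indicator_def)
  then have "(\<lambda>n. measure M (A - B n)) \<longlonglongrightarrow> 0"
    by simp
  then have "(\<lambda>n. ereal (measure M A - measure M (A - B n))) \<longlonglongrightarrow> ereal (measure M A - 0)"
    by (intro tendsto_intros)
  then have "ereal (measure M A) = liminf (\<lambda>n. ereal (measure M A - measure M (A - B n)))"
    by (intro lim_imp_Liminf[symmetric]) auto
  also have "\<dots> \<le> liminf (\<lambda>n. ereal (measure M (B n)))"
  proof (intro Liminf_mono always_eventually allI)
    fix n
    have "measure M A \<le> measure M (B n \<union> (A - B n))"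
      by (rule finite_measure_mono) auto
    also have "\<dots> \<le> measure M (B n) + measure M (A - B n)"
      by (rule measure_Un_le) auto
    finally show "ereal (measure M A - measure M (A - B n)) \<le> ereal (measure M (B n))"
      by simp
  qed
  finally show ?thesis .
qed

lemma (in prob_space) prob_tendsto_1_if_eventually:
  assumes [measurable]: "\<And>n. B n \<in> sets M"
    and ev: "AE \<omega> in M. \<forall>\<^sub>F n in sequentially. \<omega> \<in> B n"
  shows "(\<lambda>n. prob (B n)) \<longlonglongrightarrow> 1"
proof -
  have "ereal 1 \<le> liminf (\<lambda>n. ereal (prob (B n)))"
    using measure_le_liminf_measure[of "space M" B] ev by (simp add: prob_space)
  moreover have "limsup (\<lambda>n. ereal (prob (B n))) \<le> ereal 1"
    by (intro Limsup_bounded always_eventually) auto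
  ultimately have "(\<lambda>n. ereal (prob (B n))) \<longlonglongrightarrow> ereal 1"
    using Liminf_le_Limsup[of sequentially "\<lambda>n. ereal (prob (B n))"]
    by (intro Liminf_eq_Limsup) (auto intro: antisym order_trans)
  then show ?thesis by simp
qed

section \<open>Weak asymptotic arbitrage\<close>

theorem proposition4p2:
  fixes M :: "'a measure" and F :: "nat \<Rightarrow> 'a measure" and T :: nat
    and b0 a0 \<alpha> S :: real
    and bid ask :: "nat \<Rightarrow> 'a \<Rightarrow> real \<Rightarrow> real"
    and bid_inf ask_inf :: "nat \<Rightarrow> 'a \<Rightarrow> real"
    and \<beta> :: "real \<Rightarrow> real"
  assumes market: "concave_cost_market M F T b0 a0 bid ask bid_inf ask_inf"
    and alpha: "admissible_alpha M T bid ask bid_inf ask_inf \<alpha>"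
    and B1: "\<forall>t\<le>T. L_inf_norm M (ask_inf t) \<le> ereal S"
    and B2_beta: "antimono_on {0..} \<beta>" "(\<beta> \<longlongrightarrow> 0) at_top"
    and B2: "\<forall>t\<le>T. \<forall>z\<ge>0.
      max (L_inf_norm M (\<lambda>\<omega>. bid t \<omega> z - bid_inf t \<omega>))
          (L_inf_norm M (\<lambda>\<omega>. ask t \<omega> z - ask_inf t \<omega>)) \<le> ereal (\<beta> z)"
    and arbitrage: "\<exists>\<xi>. alpha_arbitrage M F T \<alpha> bid_inf ask_inf \<xi>"
  shows "\<exists>\<xi> :: nat \<Rightarrow> nat \<Rightarrow> 'a \<Rightarrow> real \<times> real.
    (\<forall>n. alpha_arbitrage M F T \<alpha> bid_inf ask_inf (\<xi> n)) \<and>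
    (\<lambda>n. \<P>(\<omega> in M. \<forall>t\<le>T. \<xi> n t \<omega> \<in>
        uminus ` solvency_set (liquidation b0 a0 (bid t \<omega>) (ask t \<omega>)))) \<longlonglongrightarrow> 1 \<and>
    liminf (\<lambda>n. ereal (\<P>(\<omega> in M.
        liquidation b0 a0 (bid T \<omega>) (ask T \<omega>) (terminal_position T (\<xi> n) \<omega>) \<ge> 0))) = 1 \<and>
    liminf (\<lambda>n. ereal (\<P>(\<omega> in M.
        liquidation b0 a0 (bid T \<omega>) (ask T \<omega>) (terminal_position T (\<xi> n) \<omega>) > 0))) > 0"
proof -
  interpret concave_cost_market M F T b0 a0 bid ask bid_inf ask_inf by (rule market)
  have \<alpha>: "0 < \<alpha>" using alpha by (simp add: admissible_alpha_def)
  obtain \<xi> where \<xi>: "alpha_arbitrage M F T \<alpha> bid_inf ask_inf \<xi>"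
    using arbitrage by blast
  \<comment> \<open>The factor \<open>n + 1\<close> instead of \<open>n\<close> makes the first member of the sequence an arbitrage as well.\<close>
  define \<eta> where "\<eta> = (\<lambda>n t \<omega>. real (Suc n) *\<^sub>R \<xi> t \<omega>)"
  define L where "L = (\<lambda>t \<omega>. liquidation b0 a0 (bid t \<omega>) (ask t \<omega>))"
  define L\<alpha> where "L\<alpha> = (\<lambda>t \<omega>. alpha_liquidation \<alpha> (bid_inf t \<omega>) (ask_inf t \<omega>))"
  define \<zeta> where "\<zeta> = terminal_position T \<xi>"
  have \<zeta>_scaled: "terminal_position T (\<eta> n) \<omega> = real (Suc n) *\<^sub>R \<zeta> \<omega>" for n \<omega>
    by (simp only: \<eta>_def \<zeta>_def terminal_position_scaleR)

  have \<xi>_meas [measurable]: "\<xi> t \<in> borel_measurable M" if "t \<le> T" for t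
    using \<xi> measurable_from_subalg[OF F_subalgebra[OF that]] that
    by (auto simp: alpha_arbitrage_def L_zero_def)
  have \<zeta>_meas [measurable]: "\<zeta> \<in> borel_measurable M"
    unfolding \<zeta>_def terminal_position_def by (auto intro!: borel_measurable_sum)
  have L_meas: "(\<lambda>\<omega>. L t \<omega> (z \<omega>)) \<in> borel_measurable M"
    if "t \<le> T" "z \<in> borel_measurable M" for t z
    unfolding L_def
    using measurable_liquidation random_curves[OF that(1)] F_subalgebra[OF that(1)] that(2) by blast
  have L_trade_meas [measurable]: "(\<lambda>\<omega>. L t \<omega> (- \<eta> n t \<omega>)) \<in> borel_measurable M"
    if "t \<le> T" for n t
    using that by (intro L_meas) (auto simp: \<eta>_def)
  have L_terminal_meas [measurable]:
      "(\<lambda>\<omega>. L T \<omega> (terminal_position T (\<eta> n) \<omega>)) \<in> borel_measurable M" for n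
    unfolding \<zeta>_scaled by (intro L_meas) auto
  have L\<alpha>_meas [measurable]: "(\<lambda>\<omega>. L\<alpha> T \<omega> (\<zeta> \<omega>)) \<in> borel_measurable M"
    unfolding L\<alpha>_def
    using measurable_inf F_subalgebra
    by (intro measurable_alpha_liquidation) (auto intro: measurable_from_subalg)

  have eventually_L: "AE \<omega> in M. \<forall>z.
      (0 \<le> L\<alpha> t \<omega> z \<longrightarrow> (\<forall>\<^sub>F n in sequentially. 0 \<le> L t \<omega> (real (Suc n) *\<^sub>R z))) \<and>
      (0 < L\<alpha> t \<omega> z \<longrightarrow> (\<forall>\<^sub>F n in sequentially. 0 < L t \<omega> (real (Suc n) *\<^sub>R z)))"
    if "t \<le> T" for t
    using bid_curve[OF that] ask_curve[OF that] bid_inf_less_ask_inf[OF that]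
    unfolding L_def L\<alpha>_def
    by eventually_elim
      (use fixed_costs \<alpha> eventually_liquidation_of_alpha_liquidation in blast)

  have "(\<lambda>n. prob {\<omega> \<in> space M. \<forall>t\<le>T. 0 \<le> L t \<omega> (- \<eta> n t \<omega>)}) \<longlonglongrightarrow> 1"
  proof (rule prob_tendsto_1_if_eventually)
    have "{\<omega> \<in> space M. \<forall>t\<in>{..T}. 0 \<le> L t \<omega> (- \<eta> n t \<omega>)} \<in> sets M" for n
      by (intro sets.sets_Collect_finite_All) auto
    then show "{\<omega> \<in> space M. \<forall>t\<le>T. 0 \<le> L t \<omega> (- \<eta> n t \<omega>)} \<in> sets M" for n
      by (simp add: Ball_def)
    have "AE \<omega> in M. \<forall>\<^sub>F n in sequentially. 0 \<le> L t \<omega> (- \<eta> n t \<omega>)" if "t \<le> T" for t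
    proof -
      have "AE \<omega> in M. 0 \<le> L\<alpha> t \<omega> (- \<xi> t \<omega>)"
        using \<xi> that
        by (auto simp: alpha_arbitrage_def L_zero_def L\<alpha>_def uminus_image_solvency_set_iff)
      then show ?thesis
        using eventually_L[OF that]
        unfolding \<eta>_def scaleR_minus_right[symmetric] by eventually_elim blast
    qed
    then have "AE \<omega> in M. \<forall>t\<in>{..T}. \<forall>\<^sub>F n in sequentially. 0 \<le> L t \<omega> (- \<eta> n t \<omega>)"
      by (intro AE_finite_allI) auto
    with AE_space
    show "AE \<omega> in M. \<forall>\<^sub>F n in sequentially.
        \<omega> \<in> {\<omega> \<in> space M. \<forall>t\<le>T. 0 \<le> L t \<omega> (- \<eta> n t \<omega>)}"
    proof eventually_elim
      case (elim \<omega>)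
      then have "\<forall>\<^sub>F n in sequentially. \<forall>t\<in>{..T}. 0 \<le> L t \<omega> (- \<eta> n t \<omega>)"
        by (intro eventually_ball_finite) auto
      then show ?case using elim(1) by (auto elim: eventually_mono)
    qed
  qed
  moreover have "(\<lambda>n. prob {\<omega> \<in> space M. 0 \<le> L T \<omega> (terminal_position T (\<eta> n) \<omega>)}) \<longlonglongrightarrow> 1"
  proof (rule prob_tendsto_1_if_eventually)
    have "prob {\<omega> \<in> space M. 0 \<le> L\<alpha> T \<omega> (\<zeta> \<omega>)} = 1"
      using \<xi> by (simp add: alpha_arbitrage_def L\<alpha>_def \<zeta>_def)
    then have "AE \<omega> in M. 0 \<le> L\<alpha> T \<omega> (\<zeta> \<omega>)"
      by (subst (asm) prob_Collect_eq_1) auto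
    with AE_space eventually_L[OF order_refl]
    show "AE \<omega> in M. \<forall>\<^sub>F n in sequentially.
        \<omega> \<in> {\<omega> \<in> space M. 0 \<le> L T \<omega> (terminal_position T (\<eta> n) \<omega>)}"
      unfolding \<zeta>_scaled by eventually_elim (auto simp del: split_paired_All)
  qed measurable
  then have "liminf (\<lambda>n. ereal (prob {\<omega> \<in> space M. 0 \<le> L T \<omega> (terminal_position T (\<eta> n) \<omega>)})) = 1"
    by (intro lim_imp_Liminf) (auto simp: one_ereal_def)
  moreover have "0 < liminf (\<lambda>n. ereal (prob {\<omega> \<in> space M. 0 < L T \<omega> (terminal_position T (\<eta> n) \<omega>)}))"
  proof -
    have "0 < ereal (prob {\<omega> \<in> space M. 0 < L\<alpha> T \<omega> (\<zeta> \<omega>)})"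
      using \<xi> by (simp add: alpha_arbitrage_def L\<alpha>_def \<zeta>_def)
    also have "\<dots> \<le> liminf (\<lambda>n. ereal (prob {\<omega> \<in> space M. 0 < L T \<omega> (terminal_position T (\<eta> n) \<omega>)}))"
    proof (rule measure_le_liminf_measure)
      show "AE \<omega> in M. \<omega> \<in> {\<omega> \<in> space M. 0 < L\<alpha> T \<omega> (\<zeta> \<omega>)} \<longrightarrow>
          (\<forall>\<^sub>F n in sequentially. \<omega> \<in> {\<omega> \<in> space M. 0 < L T \<omega> (terminal_position T (\<eta> n) \<omega>)})"
        using AE_space eventually_L[OF order_refl]
        unfolding \<zeta>_scaled by eventually_elim (auto simp del: split_paired_All)
    qed measurable
    finally show ?thesis .
  qed
  moreover have "alpha_arbitrage M F T \<alpha> bid_inf ask_inf (\<eta> n)" for n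
    unfolding \<eta>_def by (rule alpha_arbitrage_scaleR[OF \<xi>]) simp
  ultimately show ?thesis
    by (intro exI[of _ \<eta>]) (simp add: L_def uminus_image_solvency_set_iff)
qed

end
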